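(* Let $n\ge1$ and let $\phi:\mathbb{R}_+\to\mathbb{R}$ be a radial basis function whose generalised Fourier transform $\hat\phi(\|\cdot\|)$ in $n$ dimensions has the short asymptotic expansion $$\hat\phi(s)=c_0s^{-n-\beta}+c_1s^{-n-\beta+\delta}+d_0s^{-n-\beta+\eta}\log s+\cdots,\qquad s\to0,$$ where $c_0,c_1,d_0,\beta,\delta,\eta$ are real, $\delta>0$, $\eta\ge0$, and either (a) $\beta>-n$ and $c_0\ne0$, or (b) $d_0\ne0$, $\eta=0$ and $\beta\ge-n$ (in this case $c_0=0$ is allowed, and $\beta=-n$ is allowed). Then there is a function $T:\mathbb{R}^n\to\mathbb{R}$, $2\pi$-periodic in each variable, such that: (1) $T\times\hat\phi(\|\cdot\|):[-\pi,\pi]^n\to\mathbb{R}$ has a removable singularity at zero and its value at zero is one; (2) if $\hat\phi(\|\cdot\|)$ restricted to the complement of the unit ball is absolutely integrable, then the function $\hat\psi:=T\times\hat\phi(\|\cdot\|):\mathbb{R}^n\to\mathbb{R}$ is absolutely integrable and its inverse Fourier transform $\psi$ is continuous. Moreover, if the order $n+\beta$ of the singularity of $\hat\phi$ at zero is an even positive integer and the dominant term is not logarithmic (that is, $d_0=0$ or $\eta>0$), then $T$ may be chosen as a trigonometric polynomial.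
   Context: $\|\cdot\|$ is the Euclidean norm and $\mathbb{R}_+=[0,\infty)$. The generalised Fourier transform of $\phi$ in $n$ dimensions is the Fourier transform of $x\mapsto\phi(\|x\|)$, $x\in\mathbb{R}^n$, in the sense of tempered distributions (normalised as $\hat f(y)=\int_{\mathbb{R}^n} f(x)\mathrm{e}^{-\mathrm{i}\,y\cdot x}\,\mathrm{d}x$ for integrable $f$); it is assumed to agree on $\mathbb{R}^n\setminus\{0\}$ with a real-valued radial function, locally integrable on $\mathbb{R}^n\setminus\{0\}$, written $\hat\phi(\|y\|)$. In the expansion, the dots stand for further terms that are of strictly smaller order, as $s\to0$, than the dominant term; the dominant term is $c_0s^{-n-\beta}$ if $d_0=0$ or $\eta>0$, and $d_0s^{-n-\beta}\log s$ if $d_0\ne0$ and $\eta=0$. A trigonometric polynomial is a finite linear combination of the functions $y\mapsto\mathrm{e}^{-\mathrm{i}k\cdot y}$, $k\in\mathbb{Z}^n$. *)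

theory Defs
  imports "HOL-Analysis.Analysis" "HOL-Library.Landau_Symbols"
begin

definition partial_deriv :: "'n \<Rightarrow> (real^'n \<Rightarrow> complex) \<Rightarrow> real^'n \<Rightarrow> complex"
  where "partial_deriv i f x = frechet_derivative f (at x) (axis i 1)"

fun iter_partial_deriv :: "'n list \<Rightarrow> (real^'n \<Rightarrow> complex) \<Rightarrow> real^'n \<Rightarrow> complex"
  where
    "iter_partial_deriv [] f = f"
  | "iter_partial_deriv (i # is) f = partial_deriv i (iter_partial_deriv is f)"

text \<open>Differentiability here is total (Frechet) differentiability, so having all
  iterated partial derivatives differentiable everywhere amounts to being
  infinitely differentiable.\<close>

definition smooth :: "(real^'n \<Rightarrow> complex) \<Rightarrow> bool"
  where "smooth f \<longleftrightarrow> (\<forall>is x. iter_partial_deriv is f differentiable (at x))"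

definition schwartz :: "(real^'n \<Rightarrow> complex) set"
  where "schwartz = {f. smooth f \<and>
    (\<forall>(N::nat) is. bounded (range (\<lambda>x. (1 + norm x) ^ N *\<^sub>R iter_partial_deriv is f x)))}"

definition schwartz_seminorm :: "nat \<Rightarrow> (real^'n \<Rightarrow> complex) \<Rightarrow> real"
  where "schwartz_seminorm N f =
    (SUP (is, x) \<in> {is. length is \<le> N} \<times> UNIV. (1 + norm x) ^ N * cmod (iter_partial_deriv is f x))"

definition test_functions :: "(real^'n) set \<Rightarrow> (real^'n \<Rightarrow> complex) set"
  where "test_functions U = {f. smooth f \<and>
    compact (closure {x. f x \<noteq> 0}) \<and> closure {x. f x \<noteq> 0} \<subseteq> U}"

definition fourier_transform :: "(real^'n \<Rightarrow> complex) \<Rightarrow> real^'n \<Rightarrow> complex"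
  where "fourier_transform f y =
    (\<integral>x. f x * exp (- \<i> * complex_of_real (y \<bullet> x)) \<partial>lebesgue)"

definition inverse_fourier_transform :: "(real^'n \<Rightarrow> complex) \<Rightarrow> real^'n \<Rightarrow> complex"
  where "inverse_fourier_transform f x =
    (\<integral>y. f y * exp (\<i> * complex_of_real (x \<bullet> y)) \<partial>lebesgue) / (2 * complex_of_real pi) ^ CARD('n)"

text \<open>The values of a tempered distribution outside \<^const>\<open>schwartz\<close> are irrelevant.
  The last conjunct is continuity with respect to the Schwartz seminorms, which are
  increasing in \<open>N\<close>.\<close>

definition tempered_distribution :: "((real^'n \<Rightarrow> complex) \<Rightarrow> complex) \<Rightarrow> bool"
  where "tempered_distribution u \<longleftrightarrow>
    (\<forall>f\<in>schwartz. \<forall>g\<in>schwartz. u (\<lambda>x. f x + g x) = u f + u g) \<and>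
    (\<forall>c. \<forall>f\<in>schwartz. u (\<lambda>x. c * f x) = c * u f) \<and>
    (\<exists>C N. \<forall>f\<in>schwartz. cmod (u f) \<le> C * schwartz_seminorm N f)"

definition distribution_fourier ::
    "((real^'n \<Rightarrow> complex) \<Rightarrow> complex) \<Rightarrow> (real^'n \<Rightarrow> complex) \<Rightarrow> complex"
  where "distribution_fourier u f = u (fourier_transform f)"

definition locally_integrable :: "(real^'n) set \<Rightarrow> (real^'n \<Rightarrow> real) \<Rightarrow> bool"
  where "locally_integrable U f \<longleftrightarrow> (\<forall>K. compact K \<and> K \<subseteq> U \<longrightarrow> f absolutely_integrable_on K)"

definition agrees_on ::
    "((real^'n \<Rightarrow> complex) \<Rightarrow> complex) \<Rightarrow> (real^'n \<Rightarrow> real) \<Rightarrow> (real^'n) set \<Rightarrow> bool"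
  where "agrees_on u f U \<longleftrightarrow> locally_integrable U f \<and>
    (\<forall>g \<in> test_functions U. u g = (\<integral>x. complex_of_real (f x) * g x \<partial>lebesgue))"

text \<open>The tempered distribution \<open>u\<close> is determined by \<open>f\<close>, since test functions are dense
  among the Schwartz functions. Its Fourier transform may carry an arbitrary
  (singular) part at the origin; only its restriction to the complement of the origin is \<open>g\<close>.\<close>

definition generalised_fourier_transform :: "(real^'n \<Rightarrow> real) \<Rightarrow> (real^'n \<Rightarrow> real) \<Rightarrow> bool"
  where "generalised_fourier_transform f g \<longleftrightarrow>
    (\<exists>u. tempered_distribution u \<and> agrees_on u f UNIV \<and>
         agrees_on (distribution_fourier u) g (- {0}))"

definition log_dominant :: "real \<Rightarrow> real \<Rightarrow> bool"
  where "log_dominant d\<^sub>0 \<eta> \<longleftrightarrow> d\<^sub>0 \<noteq> 0 \<and> \<eta> = 0"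

text \<open>Here \<open>p\<close> is the order \<open>n + \<beta>\<close> of the singularity. The terms left out of the
  expansion are required to be of strictly smaller order than the dominant one.\<close>

definition short_expansion ::
    "real \<Rightarrow> real \<Rightarrow> real \<Rightarrow> real \<Rightarrow> real \<Rightarrow> real \<Rightarrow> (real \<Rightarrow> real) \<Rightarrow> bool"
  where "short_expansion p c\<^sub>0 c\<^sub>1 d\<^sub>0 \<delta> \<eta> F \<longleftrightarrow>
    (\<lambda>s. F s - (c\<^sub>0 * s powr (- p) + c\<^sub>1 * s powr (- p + \<delta>) + d\<^sub>0 * s powr (- p + \<eta>) * ln s))
      \<in> o[at_right 0](\<lambda>s. if log_dominant d\<^sub>0 \<eta> then d\<^sub>0 * s powr (- p) * ln s
                          else c\<^sub>0 * s powr (- p))"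

definition periodic_2pi :: "(real^'n \<Rightarrow> real) \<Rightarrow> bool"
  where "periodic_2pi T \<longleftrightarrow> (\<forall>i y. T (y + axis i (2 * pi)) = T y)"

definition trig_polynomial :: "(real^'n \<Rightarrow> complex) \<Rightarrow> bool"
  where "trig_polynomial T \<longleftrightarrow>
    (\<exists>K a. finite K \<and> (\<forall>k\<in>K. \<forall>i. k $ i \<in> \<int>) \<and>
       (\<forall>y. T y = (\<Sum>k\<in>K. a k * exp (- \<i> * complex_of_real (k \<bullet> y)))))"

end

theory Submission
  imports Defs "HOL-Real_Asymp.Real_Asymp"
begin

text \<open>
  The only obstacle to integrability of \<open>\<phi>hat (norm y)\<close> near the origin is a singularity whose
  exact strength is known from the expansion, so it suffices to multiply by a bounded
  \<open>2\<pi>\<close>-periodic function that vanishes at \<open>0\<close> at precisely that rate. A periodic substitute for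
  the Euclidean norm provides it: the function
  \<open>trig_norm y = sqrt (\<Sum>i. 2 - 2 * cos (y $ i))\<close> is continuous, bounded and periodic, and
  \<open>trig_norm y / norm y\<close> tends to \<open>1\<close> at the origin because \<open>2 - 2 * cos t\<close> behaves like \<open>t\<^sup>2\<close>.
  With \<open>p = n + \<beta>\<close>, the multiplier \<open>T = trig_norm powr p / c\<^sub>0\<close> cancels a dominant power, and
  \<open>T = trig_norm powr p / (d\<^sub>0 * ln (min trig_norm (1/2)))\<close> cancels a dominant logarithmic term.
  This gives the limit \<open>1\<close>; the lemmas on \<open>short_expansion\<close> divide the expansion by its dominant
  term, and the asymptotics of \<open>trig_norm\<close> transfer the result from \<open>norm y\<close> to \<open>trig_norm y\<close>.

  Integrability then splits into three regions. Outside the unit ball it is the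
  hypothesis, since \<open>T\<close> is bounded; on an annulus it is local integrability away from the origin;
  near the origin the product is bounded because it has a limit
  (\<open>absolutely_integrable_times_removable\<close>). The inverse Fourier transform of an integrable function
  is continuous by dominated convergence.

  When \<open>p = 2 * m\<close> with \<open>m > 0\<close>, the square root in \<open>trig_norm\<close> disappears:
  \<open>trig_norm y powr p\<close> is the \<open>m\<close>-th power of a linear combination of cosines, hence a
  trigonometric polynomial.
\<close>

section \<open>Trigonometric polynomials form an algebra\<close>

lemma trig_polynomial_zero: "trig_polynomial (\<lambda>y. 0)"
  unfolding trig_polynomial_def by (intro exI[of _ "{}"]) auto

lemma trig_polynomial_monomial:
  assumes "\<And>i. k $ i \<in> \<int>"
  shows "trig_polynomial (\<lambda>y. c * exp (- \<i> * complex_of_real (k \<bullet> y)))"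
  unfolding trig_polynomial_def
  by (intro exI[of _ "{k}"] exI[of _ "\<lambda>_. c"]) (use assms in auto)

lemma trig_polynomial_const: "trig_polynomial (\<lambda>y. c)"
  using trig_polynomial_monomial[of 0 c] by simp

lemma trig_polynomial_add:
  assumes "trig_polynomial f" "trig_polynomial g"
  shows "trig_polynomial (\<lambda>y. f y + g y)"
proof -
  obtain K a where K: "finite K" "\<forall>k\<in>K. \<forall>i. k $ i \<in> \<int>"
    and f: "\<And>y. f y = (\<Sum>k\<in>K. a k * exp (- \<i> * complex_of_real (k \<bullet> y)))"
    using assms(1) unfolding trig_polynomial_def by blast
  obtain L b where L: "finite L" "\<forall>k\<in>L. \<forall>i. k $ i \<in> \<int>"
    and g: "\<And>y. g y = (\<Sum>k\<in>L. b k * exp (- \<i> * complex_of_real (k \<bullet> y)))"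
    using assms(2) unfolding trig_polynomial_def by blast
  \<comment> \<open>The frequency sets may overlap, so both coefficient families are extended by zero.\<close>
  define c where "c k = (if k \<in> K then a k else 0) + (if k \<in> L then b k else 0)" for k
  have "f y + g y = (\<Sum>k\<in>K \<union> L. c k * exp (- \<i> * complex_of_real (k \<bullet> y)))" for y
  proof -
    have "f y = (\<Sum>k\<in>K \<union> L. (if k \<in> K then a k else 0) * exp (- \<i> * complex_of_real (k \<bullet> y)))"
      unfolding f using K(1) L(1) by (intro sum.mono_neutral_cong_left) auto
    moreover have "g y = (\<Sum>k\<in>K \<union> L. (if k \<in> L then b k else 0) * exp (- \<i> * complex_of_real (k \<bullet> y)))"
      unfolding g using K(1) L(1) by (intro sum.mono_neutral_cong_left) auto
    ultimately show ?thesis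
      by (simp add: c_def distrib_right sum.distrib)
  qed
  then show ?thesis
    unfolding trig_polynomial_def using K L
    by (intro exI[of _ "K \<union> L"] exI[of _ c]) auto
qed

lemma trig_polynomial_sum:
  assumes "finite I" "\<And>i. i \<in> I \<Longrightarrow> trig_polynomial (f i)"
  shows "trig_polynomial (\<lambda>y. \<Sum>i\<in>I. f i y)"
  using assms by (induction I) (auto simp: trig_polynomial_zero trig_polynomial_add)

lemma trig_polynomial_mult:
  assumes "trig_polynomial f" "trig_polynomial g"
  shows "trig_polynomial (\<lambda>y. f y * g y)"
proof -
  obtain K a where K: "finite K" "\<forall>k\<in>K. \<forall>i. k $ i \<in> \<int>"
    and f: "\<And>y. f y = (\<Sum>k\<in>K. a k * exp (- \<i> * complex_of_real (k \<bullet> y)))"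
    using assms(1) unfolding trig_polynomial_def by blast
  obtain L b where L: "finite L" "\<forall>k\<in>L. \<forall>i. k $ i \<in> \<int>"
    and g: "\<And>y. g y = (\<Sum>k\<in>L. b k * exp (- \<i> * complex_of_real (k \<bullet> y)))"
    using assms(2) unfolding trig_polynomial_def by blast
  have "f y * g y =
      (\<Sum>k\<in>K. \<Sum>l\<in>L. (a k * b l) * exp (- \<i> * complex_of_real ((k + l) \<bullet> y)))" for y
    unfolding f g sum_product
    by (intro sum.cong refl) (simp add: inner_add_left exp_diff exp_minus field_simps exp_add)
  moreover have "trig_polynomial (\<lambda>y. \<Sum>k\<in>K. \<Sum>l\<in>L.
      (a k * b l) * exp (- \<i> * complex_of_real ((k + l) \<bullet> y)))"
    using K L by (intro trig_polynomial_sum trig_polynomial_monomial) auto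
  ultimately show ?thesis by simp
qed

lemma trig_polynomial_power:
  assumes "trig_polynomial f"
  shows "trig_polynomial (\<lambda>y. f y ^ m)"
  by (induction m) (auto simp: trig_polynomial_const intro: trig_polynomial_mult assms)

lemma trig_polynomial_cos: "trig_polynomial (\<lambda>y :: real^'n. complex_of_real (cos (y $ i)))"
proof -
  have "complex_of_real (cos (y $ i)) =
      1/2 * exp (- \<i> * complex_of_real (axis i 1 \<bullet> y)) +
      1/2 * exp (- \<i> * complex_of_real (axis i (-1) \<bullet> y))" for y :: "real^'n"
    by (simp add: cos_of_real[symmetric] cos_exp_eq inner_axis' field_simps)
  moreover have "axis i c $ j \<in> \<int>" if "c \<in> \<int>" for c :: real and j
    using that by (auto simp: axis_def)
  ultimately show ?thesis
    by (simp only:) (intro trig_polynomial_add trig_polynomial_monomial; simp)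
qed

section \<open>A periodic substitute for the Euclidean norm\<close>

text \<open>Since \<open>2 - 2 * cos t = (2 * sin (t/2))\<^sup>2\<close>, this is the Euclidean norm of the vector with
  components \<open>2 * sin (y $ i / 2)\<close>; its zeros are the points of the period lattice. The cosine form
  makes even powers visibly trigonometric polynomials.\<close>

definition trig_norm :: "real^'n \<Rightarrow> real"
  where "trig_norm y = sqrt (\<Sum>i\<in>UNIV. 2 - 2 * cos (y $ i))"

lemma trig_norm_nonneg: "0 \<le> trig_norm y"
  by (simp add: trig_norm_def sum_nonneg)

lemma trig_norm_le: "trig_norm (y :: real^'n) \<le> sqrt (4 * real CARD('n))"
proof -
  have "(\<Sum>i\<in>(UNIV::'n set). 2 - 2 * cos (y $ i)) \<le> (\<Sum>i\<in>(UNIV::'n set). 4)"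
  proof (rule sum_mono)
    fix i show "2 - 2 * cos (y $ i) \<le> 4" using cos_ge_minus_one[of "y $ i"] by linarith
  qed
  then show ?thesis by (simp add: trig_norm_def mult.commute)
qed

lemma continuous_on_trig_norm: "continuous_on S trig_norm"
  unfolding trig_norm_def by (intro continuous_intros)

lemma trig_norm_periodic: "trig_norm (y + axis i (2 * pi)) = trig_norm y"
proof -
  have "cos ((y + axis i (2 * pi)) $ j) = cos (y $ j)" for j
    by (cases "i = j") (auto simp: axis_def)
  then show ?thesis by (simp add: trig_norm_def)
qed

lemma trig_polynomial_trig_norm_even_power:
  "trig_polynomial (\<lambda>y :: real^'n. complex_of_real (trig_norm y ^ (2 * m)))"
proof -
  have "complex_of_real (trig_norm y ^ (2 * m)) =
      (\<Sum>i\<in>UNIV. 2 + (-2) * complex_of_real (cos (y $ i))) ^ m" for y :: "real^'n"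
    by (simp add: power_mult trig_norm_def sum_nonneg)
  then show ?thesis
    by (simp only:) (intro trig_polynomial_power trig_polynomial_sum trig_polynomial_add
        trig_polynomial_mult trig_polynomial_const trig_polynomial_cos; simp)
qed

text \<open>In each coordinate \<open>2 - 2 * cos t\<close> differs from \<open>t\<^sup>2\<close> by at most \<open>(e/2) * t\<^sup>2\<close> for small \<open>t\<close>.
  These relative errors are uniform in the coordinates and add up to \<open>(e/2) * (norm y)\<^sup>2\<close>, which
  settles the squared quotient.\<close>

lemma trig_norm_asymp: "((\<lambda>y. trig_norm y / norm y) \<longlongrightarrow> 1) (at (0 :: real^'n))"
proof -
  have sq: "((\<lambda>y. (\<Sum>i\<in>UNIV. 2 - 2 * cos (y $ i)) / (norm y)\<^sup>2) \<longlongrightarrow> 1) (at (0 :: real^'n))"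
  proof (rule tendstoI)
    fix e :: real assume "e > 0"
    have "((\<lambda>t::real. (2 - 2 * cos t) / t\<^sup>2) \<longlongrightarrow> 1) (at 0)" by real_asymp
    with \<open>e > 0\<close> have "\<forall>\<^sub>F t::real in at 0. dist ((2 - 2 * cos t) / t\<^sup>2) 1 < e / 2"
      by (intro tendstoD) auto
    then obtain d where d: "d > 0" "\<And>t::real. t \<noteq> 0 \<Longrightarrow> \<bar>t\<bar> < d \<Longrightarrow> \<bar>(2 - 2 * cos t) / t\<^sup>2 - 1\<bar> < e / 2"
      unfolding eventually_at by (auto simp: dist_real_def)
    have bd: "\<bar>2 - 2 * cos t - t\<^sup>2\<bar> \<le> e / 2 * t\<^sup>2" if "\<bar>t\<bar> < d" for t
    proof (cases "t = 0")
      case False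
      have "\<bar>2 - 2 * cos t - t\<^sup>2\<bar> = \<bar>(2 - 2 * cos t) / t\<^sup>2 - 1\<bar> * t\<^sup>2"
      proof -
        have "2 - 2 * cos t - t\<^sup>2 = ((2 - 2 * cos t) / t\<^sup>2 - 1) * t\<^sup>2"
          using False by (simp add: field_simps)
        then show ?thesis by (simp only: abs_mult abs_power2)
      qed
      also have "\<dots> \<le> e / 2 * t\<^sup>2"
        using d(2)[OF False that] by (intro mult_right_mono) auto
      finally show ?thesis .
    qed simp
    have main: "dist ((\<Sum>i\<in>UNIV. 2 - 2 * cos (y $ i)) / (norm y)\<^sup>2) 1 < e"
      if "y \<noteq> 0" "norm y < d" for y :: "real^'n"
    proof -
      have ny: "(norm y)\<^sup>2 = (\<Sum>i\<in>UNIV. (y $ i)\<^sup>2)"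
        by (simp add: norm_vec_def L2_set_def sum_nonneg)
      have "\<bar>(\<Sum>i\<in>UNIV. 2 - 2 * cos (y $ i)) - (norm y)\<^sup>2\<bar> =
          \<bar>\<Sum>i\<in>UNIV. 2 - 2 * cos (y $ i) - (y $ i)\<^sup>2\<bar>"
        unfolding ny by (simp add: sum_subtractf)
      also have "\<dots> \<le> (\<Sum>i\<in>UNIV. e / 2 * (y $ i)\<^sup>2)"
        using that component_le_norm_cart[of y]
        by (intro order.trans[OF sum_abs] sum_mono bd) (meson le_less_trans)
      also have "\<dots> = e / 2 * (norm y)\<^sup>2" by (simp add: ny sum_distrib_left)
      finally have *: "\<bar>(\<Sum>i\<in>UNIV. 2 - 2 * cos (y $ i)) - (norm y)\<^sup>2\<bar> \<le> e / 2 * (norm y)\<^sup>2" .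
      have pos: "(norm y)\<^sup>2 > 0" using that by simp
      have "dist ((\<Sum>i\<in>UNIV. 2 - 2 * cos (y $ i)) / (norm y)\<^sup>2) 1 =
          \<bar>(\<Sum>i\<in>UNIV. 2 - 2 * cos (y $ i)) - (norm y)\<^sup>2\<bar> / (norm y)\<^sup>2"
      proof -
        have "x / c - 1 = (x - c) / c" if "c > 0" for x c :: real
          using that by (simp add: field_simps)
        then show ?thesis using pos by (simp add: dist_real_def del: zero_less_power2)
      qed
      also have "\<dots> \<le> e / 2" using * pos by (simp add: pos_divide_le_eq)
      finally show ?thesis using \<open>e > 0\<close> by simp
    qed
    show "\<forall>\<^sub>F y :: real^'n in at 0. dist ((\<Sum>i\<in>UNIV. 2 - 2 * cos (y $ i)) / (norm y)\<^sup>2) 1 < e"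
      unfolding eventually_at using d(1) main by (intro exI[of _ d]) auto
  qed
  show ?thesis
    using tendsto_real_sqrt[OF sq] by (simp add: trig_norm_def real_sqrt_divide)
qed

section \<open>Integrability and the inverse Fourier transform\<close>

text \<open>The exponential has modulus one, so \<open>norm (f y)\<close> dominates the integrand uniformly in
  \<open>x\<close>, and the integral inherits sequential continuity.\<close>

lemma continuous_on_inverse_fourier_transform:
  fixes f :: "real^'n \<Rightarrow> complex"
  assumes "integrable lebesgue f"
  shows "continuous_on UNIV (inverse_fourier_transform f)"
proof -
  have "isCont (\<lambda>x. \<integral>y. f y * exp (\<i> * complex_of_real (x \<bullet> y)) \<partial>lebesgue) x" for x :: "real^'n"
    unfolding continuous_at_sequentially comp_def
  proof (intro allI impI)
    fix X :: "nat \<Rightarrow> real^'n" assume X: "X \<longlonglongrightarrow> x"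
    have meas: "(\<lambda>y. f y * exp (\<i> * complex_of_real (z \<bullet> y))) \<in> borel_measurable lebesgue" for z
    proof (rule borel_measurable_times)
      show "f \<in> borel_measurable lebesgue" using assms by simp
      show "(\<lambda>y. exp (\<i> * complex_of_real (z \<bullet> y))) \<in> borel_measurable lebesgue"
        using continuous_imp_measurable_on_sets_lebesgue[where S = UNIV
            and f = "\<lambda>y. exp (\<i> * complex_of_real (z \<bullet> y))"]
        by (simp add: continuous_intros lebesgue_on_UNIV_eq)
    qed
    show "(\<lambda>k. \<integral>y. f y * exp (\<i> * complex_of_real (X k \<bullet> y)) \<partial>lebesgue) \<longlonglongrightarrow>
        (\<integral>y. f y * exp (\<i> * complex_of_real (x \<bullet> y)) \<partial>lebesgue)"
    proof (rule integral_dominated_convergence[where w = "\<lambda>y. norm (f y)"])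
      show "AE y in lebesgue. (\<lambda>k. f y * exp (\<i> * complex_of_real (X k \<bullet> y)))
          \<longlonglongrightarrow> f y * exp (\<i> * complex_of_real (x \<bullet> y))"
        by (intro AE_I2 tendsto_intros X)
    qed (use assms meas in \<open>auto simp: norm_mult\<close>)
  qed
  then have "continuous_on UNIV
      (\<lambda>x::real^'n. \<integral>y. f y * exp (\<i> * complex_of_real (x \<bullet> y)) \<partial>lebesgue)"
    by (simp add: continuous_at_imp_continuous_on)
  then show ?thesis
    unfolding inverse_fourier_transform_def by (intro continuous_intros) auto
qed

text \<open>The function \<open>f\<close> may fail to be integrable near \<open>0\<close>, but \<open>T * f\<close> is bounded there
  by the limit assumption. Local integrability away from \<open>0\<close> supplies both the
  integrability on annuli and the measurability of \<open>f\<close> up to the origin.\<close>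

lemma absolutely_integrable_times_removable:
  fixes T f :: "real^'n \<Rightarrow> real"
  assumes loc: "locally_integrable (- {0}) f"
    and tail: "f absolutely_integrable_on (- ball 0 1)"
    and T: "T \<in> borel_measurable lebesgue" "bounded (range T)"
    and lim: "((\<lambda>y. T y * f y) \<longlongrightarrow> l) (at 0)"
  shows "(\<lambda>y. T y * f y) absolutely_integrable_on UNIV"
proof -
  have outer: "f absolutely_integrable_on (- ball 0 e)" if "e > 0" for e
  proof -
    have "compact (cball 0 1 - ball (0::real^'n) e)"
      by (intro compact_diff) auto
    then have "f absolutely_integrable_on (cball 0 1 - ball 0 e)"
      using loc that unfolding locally_integrable_def by auto
    then have "f absolutely_integrable_on ((cball 0 1 - ball 0 e) \<union> - ball 0 1)"
      using tail by (rule set_integrable_Un) auto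
    then show ?thesis
      by (rule set_integrable_subset) auto
  qed
  \<comment> \<open>Exhausting the punctured space by complements of shrinking balls, on each of which \<open>f\<close> is
    integrable, shows that \<open>f\<close> is measurable there.\<close>
  have f_meas: "(\<lambda>y. indicator (- {0}) y * f y) \<in> borel_measurable lebesgue"
  proof (rule borel_measurable_LIMSEQ_real)
    fix k :: nat
    show "(\<lambda>y. indicator (- ball 0 (1 / Suc k)) y * f y) \<in> borel_measurable lebesgue"
      using outer[of "1 / Suc k"] unfolding set_integrable_def
      by (auto dest: borel_measurable_integrable)
  next
    fix y :: "real^'n"
    show "(\<lambda>k. indicator (- ball 0 (1 / Suc k)) y * f y) \<longlonglongrightarrow> indicator (- {0}) y * f y"
    proof (cases "y = 0")
      case False
      then obtain N where N: "1 / Suc N < norm y"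
        using nat_approx_posE[of "norm y"] by auto
      have "\<forall>\<^sub>F k in sequentially. indicator (- {0}) y * f y = indicator (- ball 0 (1 / Suc k)) y * f y"
        using eventually_ge_at_top[of N]
      proof eventually_elim
        case (elim k)
        then have "1 / real (Suc k) \<le> 1 / Suc N" by (intro divide_left_mono) auto
        with N False show ?case by (simp add: indicator_def)
      qed
      then show ?thesis by (rule Lim_transform_eventually[OF tendsto_const])
    qed auto
  qed
  obtain e where e: "e > 0" "\<And>y. y \<noteq> 0 \<Longrightarrow> norm y < e \<Longrightarrow> \<bar>T y * f y\<bar> \<le> \<bar>l\<bar> + 1"
  proof -
    have "\<forall>\<^sub>F y in at 0. dist (T y * f y) l < 1" using lim by (rule tendstoD) simp
    then obtain e where "e > 0" "\<And>y. y \<noteq> 0 \<Longrightarrow> norm y < e \<Longrightarrow> \<bar>T y * f y - l\<bar> < 1"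
      unfolding eventually_at by (auto simp: dist_real_def)
    then show ?thesis by (intro that[of e]) force+
  qed
  have "(\<lambda>y. T y * f y) absolutely_integrable_on (- ball 0 e)"
  proof (rule absolutely_integrable_bounded_measurable_product[OF bilinear_times])
    show "T \<in> borel_measurable (lebesgue_on (- ball 0 e))"
      using T(1) by (rule measurable_restrict_space1)
    show "bounded (T ` (- ball 0 e))" using T(2) by (rule bounded_subset) auto
  qed (use outer e in auto)
  moreover have "(\<lambda>y. T y * f y) absolutely_integrable_on (ball 0 e - {0})"
  proof (rule measurable_bounded_by_integrable_imp_absolutely_integrable[where g = "\<lambda>_. \<bar>l\<bar> + 1"])
    have "(\<lambda>y. T y * (indicator (- {0}) y * f y)) \<in> borel_measurable (lebesgue_on (ball 0 e - {0}))"
      by (intro measurable_restrict_space1 borel_measurable_times[OF T(1) f_meas])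
    then show "(\<lambda>y. T y * f y) \<in> borel_measurable (lebesgue_on (ball 0 e - {0}))"
      by (rule iffD1[OF measurable_cong, rotated]) auto
    show "(\<lambda>_. \<bar>l\<bar> + 1) integrable_on (ball 0 e - {0} :: (real^'n) set)"
      by (intro integrable_on_const bounded_set_imp_lmeasurable) (auto intro: bounded_subset[OF bounded_ball])
  qed (use e in auto)
  ultimately have "(\<lambda>y. T y * f y) absolutely_integrable_on (- ball 0 e \<union> (ball 0 e - {0}))"
    by (rule set_integrable_Un) auto
  then show ?thesis
    by (rule absolutely_integrable_spike_set) (rule negligible_subset[of "{0}"]; auto)+
qed

section \<open>Extracting the dominant term of the expansion\<close>

text \<open>Dividing the expansion by \<open>c\<^sub>0 * s powr (- p)\<close> leaves \<open>1\<close>, a multiple of \<open>s powr \<delta>\<close>, a multiple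
  of \<open>s powr \<eta> * ln s\<close>, and the remainder. The logarithmic summand either has coefficient \<open>0\<close> or has
  \<open>\<eta> > 0\<close>, so that the power beats the logarithm.\<close>

lemma short_expansion_power_dominant:
  assumes "short_expansion p c\<^sub>0 c\<^sub>1 d\<^sub>0 \<delta> \<eta> F" "\<not> log_dominant d\<^sub>0 \<eta>"
    and "c\<^sub>0 \<noteq> 0" "\<delta> > 0" "\<eta> \<ge> 0"
  shows "((\<lambda>s. F s * (s powr p / c\<^sub>0)) \<longlongrightarrow> 1) (at_right 0)"
proof -
  let ?G = "\<lambda>s. c\<^sub>0 * s powr (- p) + c\<^sub>1 * s powr (- p + \<delta>) + d\<^sub>0 * s powr (- p + \<eta>) * ln s"
  have "(\<lambda>s. F s - ?G s) \<in> o[at_right 0](\<lambda>s. c\<^sub>0 * s powr (- p))"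
    using assms(1,2) by (simp add: short_expansion_def)
  then have rest: "((\<lambda>s. (F s - ?G s) / (c\<^sub>0 * s powr (- p))) \<longlongrightarrow> 0) (at_right 0)"
    by (rule smalloD_tendsto)
  have pow: "((\<lambda>s::real. s powr \<delta>) \<longlongrightarrow> 0) (at_right 0)"
    using \<open>\<delta> > 0\<close> by real_asymp
  have log: "((\<lambda>s. d\<^sub>0 * (s powr \<eta> * ln s)) \<longlongrightarrow> 0) (at_right 0)"
  proof (cases "d\<^sub>0 = 0")
    case False
    then have "\<eta> > 0" using assms unfolding log_dominant_def by auto
    then show ?thesis by real_asymp
  qed simp
  have "((\<lambda>s. (F s - ?G s) / (c\<^sub>0 * s powr (- p)) + (1 + c\<^sub>1 / c\<^sub>0 * s powr \<delta> +
      d\<^sub>0 * (s powr \<eta> * ln s) / c\<^sub>0)) \<longlongrightarrow> 0 + (1 + c\<^sub>1 / c\<^sub>0 * 0 + 0 / c\<^sub>0)) (at_right 0)"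
    using \<open>c\<^sub>0 \<noteq> 0\<close> by (intro tendsto_intros rest pow log)
  then have "((\<lambda>s. (F s - ?G s) / (c\<^sub>0 * s powr (- p)) + (1 + c\<^sub>1 / c\<^sub>0 * s powr \<delta> +
      d\<^sub>0 * (s powr \<eta> * ln s) / c\<^sub>0)) \<longlongrightarrow> 1) (at_right 0)" by simp
  then show ?thesis
  proof (rule Lim_transform_eventually)
    show "\<forall>\<^sub>F s in at_right 0. (F s - ?G s) / (c\<^sub>0 * s powr (- p)) + (1 + c\<^sub>1 / c\<^sub>0 * s powr \<delta> +
      d\<^sub>0 * (s powr \<eta> * ln s) / c\<^sub>0) = F s * (s powr p / c\<^sub>0)"
      using eventually_at_right_less[of "0::real"]
      by eventually_elim (use \<open>c\<^sub>0 \<noteq> 0\<close> in \<open>simp add: powr_add powr_minus powr_diff field_simps\<close>)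
  qed
qed

text \<open>Here the pure powers are the lower-order terms: divided by the dominant term they become
  multiples of \<open>1 / ln s\<close> and \<open>s powr \<delta> / ln s\<close>, and \<open>ln s\<close> is unbounded at \<open>0\<close>.\<close>

lemma short_expansion_log_dominant:
  assumes "short_expansion p c\<^sub>0 c\<^sub>1 d\<^sub>0 \<delta> \<eta> F" "log_dominant d\<^sub>0 \<eta>" "\<delta> > 0"
  shows "((\<lambda>s. F s * (s powr p / (d\<^sub>0 * ln s))) \<longlongrightarrow> 1) (at_right 0)"
proof -
  have d0: "d\<^sub>0 \<noteq> 0" and eta: "\<eta> = 0"
    using assms(2) by (auto simp: log_dominant_def)
  let ?G = "\<lambda>s. c\<^sub>0 * s powr (- p) + c\<^sub>1 * s powr (- p + \<delta>) + d\<^sub>0 * s powr (- p + \<eta>) * ln s"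
  have "(\<lambda>s. F s - ?G s) \<in> o[at_right 0](\<lambda>s. d\<^sub>0 * s powr (- p) * ln s)"
    using assms(1,2) by (simp add: short_expansion_def)
  then have rest: "((\<lambda>s. (F s - ?G s) / (d\<^sub>0 * s powr (- p) * ln s)) \<longlongrightarrow> 0) (at_right 0)"
    by (rule smalloD_tendsto)
  have inv_log: "((\<lambda>s::real. inverse (ln s)) \<longlongrightarrow> 0) (at_right 0)" by real_asymp
  have pow: "((\<lambda>s::real. s powr \<delta>) \<longlongrightarrow> 0) (at_right 0)"
    using \<open>\<delta> > 0\<close> by real_asymp
  have "((\<lambda>s. (F s - ?G s) / (d\<^sub>0 * s powr (- p) * ln s) +
      (c\<^sub>0 / d\<^sub>0 * inverse (ln s) + c\<^sub>1 / d\<^sub>0 * (s powr \<delta> * inverse (ln s)) + 1)) \<longlongrightarrow>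
      0 + (c\<^sub>0 / d\<^sub>0 * 0 + c\<^sub>1 / d\<^sub>0 * (0 * 0) + 1)) (at_right 0)"
    by (intro tendsto_intros rest pow inv_log)
  then have "((\<lambda>s. (F s - ?G s) / (d\<^sub>0 * s powr (- p) * ln s) +
      (c\<^sub>0 / d\<^sub>0 * inverse (ln s) + c\<^sub>1 / d\<^sub>0 * (s powr \<delta> * inverse (ln s)) + 1)) \<longlongrightarrow> 1) (at_right 0)"
    by simp
  moreover have "\<forall>\<^sub>F s in at_right (0::real). s < 1"
    by (rule eventually_at_rightI[of 0 1]) auto
  then have "\<forall>\<^sub>F s in at_right 0. (F s - ?G s) / (d\<^sub>0 * s powr (- p) * ln s) +
      (c\<^sub>0 / d\<^sub>0 * inverse (ln s) + c\<^sub>1 / d\<^sub>0 * (s powr \<delta> * inverse (ln s)) + 1) =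
      F s * (s powr p / (d\<^sub>0 * ln s))"
    using eventually_at_right_less[of "0::real"]
  proof eventually_elim
    case (elim s)
    then have "ln s < 0" by simp
    then show ?case using elim d0 by (simp add: eta powr_add powr_minus powr_diff field_simps)
  qed
  ultimately show ?thesis by (rule Lim_transform_eventually)
qed

section \<open>Passing from the norm to its periodic substitute\<close>

lemma filterlim_norm_at_right_0: "filterlim norm (at_right 0) (at (0 :: 'a :: real_normed_vector))"
proof -
  have "(norm \<longlongrightarrow> 0) (at (0 :: 'a))"
    using tendsto_norm[OF tendsto_ident_at, of "0 :: 'a"] by simp
  moreover have "\<forall>\<^sub>F y in at (0 :: 'a). norm y \<in> {0<..} \<and> norm y \<noteq> 0"
    by (simp add: eventually_at_filter)
  ultimately show ?thesis by (simp add: filterlim_at)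
qed

lemma trig_norm_powr_asymp:
  "((\<lambda>y. trig_norm y powr p / norm y powr p) \<longlongrightarrow> 1) (at (0 :: real^'n))"
proof -
  have "((\<lambda>y. (trig_norm y / norm y) powr p) \<longlongrightarrow> 1 powr p) (at (0 :: real^'n))"
    by (intro tendsto_powr trig_norm_asymp tendsto_const) simp
  then show ?thesis by (simp only: powr_divide powr_one_eq_one)
qed

lemma tendsto_trig_norm_0: "(trig_norm \<longlongrightarrow> 0) (at (0 :: real^'n))"
proof -
  have "isCont trig_norm (0 :: real^'n)"
    using continuous_on_trig_norm[of UNIV] by (metis continuous_on_eq_continuous_at open_UNIV UNIV_I)
  moreover have "trig_norm (0 :: real^'n) = 0"
    by (simp add: trig_norm_def)
  ultimately show ?thesis by (simp only: isCont_def)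
qed

text \<open>The logarithms differ by \<open>ln (trig_norm y / norm y)\<close>, which tends to \<open>0\<close>, while \<open>ln (norm y)\<close>
  tends to minus infinity. The cap \<open>1/2\<close> is inactive near the origin; elsewhere it keeps the
  logarithm in the denominator of the multiplier away from \<open>0\<close>.\<close>

lemma trig_norm_ln_asymp:
  "((\<lambda>y. ln (norm y) / ln (min (trig_norm y) (1/2))) \<longlongrightarrow> 1) (at (0 :: real^'n))"
proof -
  have "((\<lambda>s::real. inverse (ln s)) \<longlongrightarrow> 0) (at_right 0)" by real_asymp
  then have inv_ln: "((\<lambda>y. inverse (ln (norm y))) \<longlongrightarrow> 0) (at (0 :: real^'n))"
    by (rule filterlim_compose[OF _ filterlim_norm_at_right_0])
  have "((\<lambda>y. inverse (1 + ln (trig_norm y / norm y) * inverse (ln (norm y)))) \<longlongrightarrow>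
      inverse (1 + ln 1 * 0)) (at (0 :: real^'n))"
    by (intro tendsto_intros trig_norm_asymp inv_ln) auto
  then have lim: "((\<lambda>y. inverse (1 + ln (trig_norm y / norm y) * inverse (ln (norm y)))) \<longlongrightarrow> 1)
      (at (0 :: real^'n))" by simp
  have "\<forall>\<^sub>F y in at (0 :: real^'n). 0 < trig_norm y / norm y"
    using trig_norm_asymp by (rule order_tendstoD) simp
  moreover have "\<forall>\<^sub>F y in at (0 :: real^'n). trig_norm y < 1/2"
    using tendsto_trig_norm_0 by (rule order_tendstoD) simp
  moreover have "\<forall>\<^sub>F y in at (0 :: real^'n). norm y < 1"
    using tendsto_norm[OF tendsto_ident_at, of "0 :: real^'n"] by (rule order_tendstoD) simp
  ultimately have "\<forall>\<^sub>F y in at (0 :: real^'n).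
      inverse (1 + ln (trig_norm y / norm y) * inverse (ln (norm y))) =
      ln (norm y) / ln (min (trig_norm y) (1/2))"
  proof eventually_elim
    case (elim y)
    then have "norm y > 0" "trig_norm y > 0"
      by (auto simp: zero_less_divide_iff not_less)
    moreover from this elim have "ln (norm y) < 0" "min (trig_norm y) (1/2) = trig_norm y"
      by auto
    ultimately show ?case
      by (simp add: ln_div field_simps)
  qed
  with lim show ?thesis by (rule Lim_transform_eventually)
qed

section \<open>The periodic multiplier\<close>

theorem theorem4:
  fixes \<phi> \<phi>hat :: "real \<Rightarrow> real"
    and c\<^sub>0 c\<^sub>1 d\<^sub>0 \<beta> \<delta> \<eta> :: real
  defines "n \<equiv> real CARD('n::finite)"
  assumes "generalised_fourier_transform (\<lambda>x::real^'n. \<phi> (norm x)) (\<lambda>y. \<phi>hat (norm y))"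
    and "short_expansion (n + \<beta>) c\<^sub>0 c\<^sub>1 d\<^sub>0 \<delta> \<eta> \<phi>hat"
    and "\<delta> > 0" and "\<eta> \<ge> 0"
    and "(\<beta> > - n \<and> c\<^sub>0 \<noteq> 0) \<or> (d\<^sub>0 \<noteq> 0 \<and> \<eta> = 0 \<and> \<beta> \<ge> - n)"
  shows "\<exists>T :: real^'n \<Rightarrow> real.
    periodic_2pi T \<and>
    ((\<lambda>y. T y * \<phi>hat (norm y)) \<longlongrightarrow> 1) (at 0 within {y. \<forall>i. - pi \<le> y $ i \<and> y $ i \<le> pi}) \<and>
    ((\<lambda>y::real^'n. \<phi>hat (norm y)) absolutely_integrable_on (- ball 0 1) \<longrightarrow>
       (\<lambda>y. T y * \<phi>hat (norm y)) absolutely_integrable_on UNIV \<and>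
       continuous_on UNIV
         (inverse_fourier_transform (\<lambda>y. complex_of_real (T y * \<phi>hat (norm y))))) \<and>
    ((\<exists>m::nat. m > 0 \<and> n + \<beta> = 2 * real m) \<and> \<not> log_dominant d\<^sub>0 \<eta> \<longrightarrow>
       trig_polynomial (\<lambda>y. complex_of_real (T y)))"
proof -
  define p where "p = n + \<beta>"
  have p: "p \<ge> 0" using assms(6) by (auto simp: p_def)
  have exp: "short_expansion p c\<^sub>0 c\<^sub>1 d\<^sub>0 \<delta> \<eta> \<phi>hat" using assms(3) by (simp add: p_def)
  have c0: "c\<^sub>0 \<noteq> 0" if "\<not> log_dominant d\<^sub>0 \<eta>"
    using assms(6) that by (auto simp: log_dominant_def)
  have loc: "locally_integrable (- {0}) (\<lambda>y::real^'n. \<phi>hat (norm y))"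
    using assms(2) by (auto simp: generalised_fourier_transform_def agrees_on_def)
  \<comment> \<open>At the points of the period lattice both \<open>0 powr p\<close> and \<open>ln 0\<close> have the value \<open>0\<close>, so \<open>T\<close>
    vanishes there in every case, including \<open>p = 0\<close>.\<close>
  define D where "D y = (if log_dominant d\<^sub>0 \<eta> then d\<^sub>0 * ln (min (trig_norm y) (1/2)) else c\<^sub>0)"
    for y :: "real^'n"
  define T where "T y = trig_norm y powr p / D y" for y :: "real^'n"
  have lim: "((\<lambda>y. T y * \<phi>hat (norm y)) \<longlongrightarrow> 1) (at 0)"
  proof (cases "log_dominant d\<^sub>0 \<eta>")
    case True
    have "((\<lambda>y. (trig_norm y powr p / norm y powr p) * (ln (norm y) / ln (min (trig_norm y) (1/2))) *
        (\<phi>hat (norm y) * (norm y powr p / (d\<^sub>0 * ln (norm y))))) \<longlongrightarrow> 1 * 1 * 1) (at (0 :: real^'n))"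
      by (intro tendsto_mult trig_norm_powr_asymp trig_norm_ln_asymp
          filterlim_compose[OF short_expansion_log_dominant[OF exp True assms(4)] filterlim_norm_at_right_0])
    then have "((\<lambda>y. (trig_norm y powr p / norm y powr p) * (ln (norm y) / ln (min (trig_norm y) (1/2))) *
        (\<phi>hat (norm y) * (norm y powr p / (d\<^sub>0 * ln (norm y))))) \<longlongrightarrow> 1) (at (0 :: real^'n))"
      by simp
    moreover have "\<forall>\<^sub>F y in at (0 :: real^'n). norm y < 1 \<and> y \<noteq> 0"
      unfolding eventually_at by (intro exI[of _ 1]) auto
    then have "\<forall>\<^sub>F y in at (0 :: real^'n).
        (trig_norm y powr p / norm y powr p) * (ln (norm y) / ln (min (trig_norm y) (1/2))) *
        (\<phi>hat (norm y) * (norm y powr p / (d\<^sub>0 * ln (norm y)))) = T y * \<phi>hat (norm y)"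
      by eventually_elim (use True in \<open>simp add: T_def D_def\<close>)
    ultimately show ?thesis by (rule Lim_transform_eventually)
  next
    case False
    have "((\<lambda>y. (trig_norm y powr p / norm y powr p) * (\<phi>hat (norm y) * (norm y powr p / c\<^sub>0)))
        \<longlongrightarrow> 1 * 1) (at (0 :: real^'n))"
      by (intro tendsto_mult trig_norm_powr_asymp
          filterlim_compose[OF short_expansion_power_dominant[OF exp False c0[OF False] assms(4,5)]
            filterlim_norm_at_right_0])
    then have "((\<lambda>y. (trig_norm y powr p / norm y powr p) * (\<phi>hat (norm y) * (norm y powr p / c\<^sub>0)))
        \<longlongrightarrow> 1) (at (0 :: real^'n))" by simp
    moreover have "\<forall>\<^sub>F y in at (0 :: real^'n). y \<noteq> 0"
      by (simp add: eventually_at_filter)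
    then have "\<forall>\<^sub>F y in at (0 :: real^'n).
        (trig_norm y powr p / norm y powr p) * (\<phi>hat (norm y) * (norm y powr p / c\<^sub>0)) = T y * \<phi>hat (norm y)"
      by eventually_elim (use False in \<open>simp add: T_def D_def\<close>)
    ultimately show ?thesis by (rule Lim_transform_eventually)
  qed
  \<comment> \<open>The values with \<open>D y = 0\<close>, which arise from \<open>ln 0 = 0\<close>, are harmless: there \<open>T y = 0\<close> by
    the convention for division by zero.\<close>
  have D_lower: "\<exists>c>0. \<forall>y. D y = 0 \<or> c \<le> \<bar>D y\<bar>"
  proof (cases "log_dominant d\<^sub>0 \<eta>")
    case True
    have "\<bar>d\<^sub>0\<bar> * ln 2 \<le> \<bar>D y\<bar>" if "D y \<noteq> 0" for y
    proof -
      have "trig_norm y > 0"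
        using that trig_norm_nonneg[of y] by (cases "trig_norm y = 0") (auto simp: D_def True)
      then have "ln (min (trig_norm y) (1/2)) \<le> ln (1/2)" by (subst ln_le_cancel_iff) auto
      then have "ln 2 \<le> \<bar>ln (min (trig_norm y) (1/2))\<bar>" by (simp add: ln_div)
      then show ?thesis by (simp add: D_def True abs_mult mult_left_mono)
    qed
    moreover have "\<bar>d\<^sub>0\<bar> * ln 2 > 0" using True by (simp add: log_dominant_def)
    ultimately show ?thesis by blast
  next
    case False
    then show ?thesis using c0 by (intro exI[of _ "\<bar>c\<^sub>0\<bar>"]) (auto simp: D_def)
  qed
  have T_bounded: "bounded (range T)"
  proof -
    obtain c where c: "c > 0" "\<And>y. D y = 0 \<or> c \<le> \<bar>D y\<bar>" using D_lower by blast
    have "\<bar>T y\<bar> \<le> sqrt (4 * n) powr p / c" for y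
    proof (cases "D y = 0")
      case False
      then show ?thesis using c(1) c(2)[of y] p trig_norm_nonneg[of y] trig_norm_le[of y]
        by (auto simp: T_def abs_divide n_def intro!: frac_le powr_mono2)
    qed (use c in \<open>simp add: T_def\<close>)
    then show ?thesis by (auto simp: bounded_iff)
  qed
  have trig_norm_meas: "trig_norm \<in> borel_measurable (lebesgue :: (real^'n) measure)"
    using continuous_imp_measurable_on_sets_lebesgue[OF continuous_on_trig_norm, of UNIV]
    by (simp add: lebesgue_on_UNIV_eq)
  have "D \<in> borel_measurable lebesgue"
    unfolding D_def using trig_norm_meas by (cases "log_dominant d\<^sub>0 \<eta>") simp_all
  then have T_meas: "T \<in> borel_measurable lebesgue"
    unfolding T_def using trig_norm_meas by measurable
  have int: "(\<lambda>y. T y * \<phi>hat (norm y)) absolutely_integrable_on UNIV"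
    if "(\<lambda>y::real^'n. \<phi>hat (norm y)) absolutely_integrable_on (- ball 0 1)"
    using loc that T_meas T_bounded lim by (rule absolutely_integrable_times_removable)
  show ?thesis
  proof (intro exI[of _ T] conjI impI)
    show "periodic_2pi T" by (simp add: periodic_2pi_def T_def D_def trig_norm_periodic)
    show "((\<lambda>y. T y * \<phi>hat (norm y)) \<longlongrightarrow> 1) (at 0 within {y. \<forall>i. - pi \<le> y $ i \<and> y $ i \<le> pi})"
      using lim by (rule tendsto_within_subset) auto
  next
    assume "(\<lambda>y::real^'n. \<phi>hat (norm y)) absolutely_integrable_on (- ball 0 1)"
    note int[OF this]
    then show "continuous_on UNIV
         (inverse_fourier_transform (\<lambda>y. complex_of_real (T y * \<phi>hat (norm y))))"
      by (intro continuous_on_inverse_fourier_transform integrable_of_real) (simp add: set_integrable_def)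
  next
    assume "(\<exists>m::nat. m > 0 \<and> n + \<beta> = 2 * real m) \<and> \<not> log_dominant d\<^sub>0 \<eta>"
    then obtain m :: nat where m: "m > 0" "p = real (2 * m)" and nolog: "\<not> log_dominant d\<^sub>0 \<eta>"
      by (auto simp: p_def)
    \<comment> \<open>Positivity of \<open>m\<close> matters where \<open>trig_norm y = 0\<close>: \<open>0 powr 0 = 0\<close>, whereas \<open>0 ^ 0 = 1\<close>.\<close>
    have "trig_norm y powr p = trig_norm y ^ (2 * m)" for y :: "real^'n"
      unfolding m(2) using m(1) trig_norm_nonneg[of y] by (intro powr_realpow') auto
    then have "complex_of_real (T y) = complex_of_real (trig_norm y ^ (2 * m)) * complex_of_real (1 / c\<^sub>0)" for y
      by (simp add: T_def D_def nolog)
    then show "trig_polynomial (\<lambda>y. complex_of_real (T y))"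
      by (simp only:) (intro trig_polynomial_mult trig_polynomial_trig_norm_even_power trig_polynomial_const)
  qed (use int in auto)
qed

end
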